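(* Let $B$ and $C$ be (nonempty) essentially countable directed preorders, and let $\mathbf{B}$ and $\mathbf{C}$ be the same preorders understood as thin categories. Then $B\le_T C$ as preordered sets if and only if there is a pre-adjunction from $\mathbf{B}$ to $\mathbf{C}$.
   Context: A preorder is a set $A$ together with a reflexive and transitive relation $\le$. Elements $a,b\in A$ are equivalent, $a\equiv b$, if $a\le b$ and $b\le a$; $A$ is essentially countable if $A/{\equiv}$ is (at most) countable. A nonempty set $X\subseteq A$ is bounded if there is $b\in A$ with $x\le b$ for all $x\in X$, and unbounded otherwise. A preorder is directed if every two-element subset is bounded. A map $f:A\to B$ between directed preorders is a Tukey map if for every $X\subseteq A$ unbounded in $A$ the image $f(X)$ is unbounded in $B$. For directed preorders, $A\le_T B$ means that there is a Tukey map $A\to B$. A preorder $A$ is viewed as a small thin category $\mathbf{A}$ with $\mathrm{Ob}(\mathbf{A})=A$ and with exactly one morphism $a\to b$ if $a\le b$, and none otherwise. Pre-adjunction: for locally small categories $\mathbf{B}$ and $\mathbf{C}$, a pair of maps $F:\mathrm{Ob}(\mathbf{B})\to\mathrm{Ob}(\mathbf{C})$, $H:\mathrm{Ob}(\mathbf{C})\to\mathrm{Ob}(\mathbf{B})$ (not required to be functorial) is a pre-adjunction from $\mathbf{B}$ to $\mathbf{C}$ if there is a family of maps $\Phi_{X,Y}:\hom_{\mathbf{C}}(F(X),Y)\to\hom_{\mathbf{B}}(X,H(Y))$ indexed by pairs $(X,Y)\in\mathrm{Ob}(\mathbf{B})\times\mathrm{Ob}(\mathbf{C})$ such that: (PA)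 for every $C\in\mathrm{Ob}(\mathbf{C})$, all $A,B\in\mathrm{Ob}(\mathbf{B})$, every $u\in\hom_{\mathbf{C}}(F(B),C)$ and every $f\in\hom_{\mathbf{B}}(A,B)$ there is a $v\in\hom_{\mathbf{C}}(F(A),F(B))$ with $\Phi_{B,C}(u)\cdot f=\Phi_{A,C}(u\cdot v)$. Here $f\cdot g$ means first $g$, then $f$. *)

theory Defs
  imports "HOL-Library.Countable_Set" "HOL-Library.FuncSet"
begin

section \<open>Preorders and Tukey maps\<close>

definition essentially_countable :: "'a set \<Rightarrow> 'a rel \<Rightarrow> bool" where
  "essentially_countable A r \<longleftrightarrow> countable (A // (r \<inter> r\<inverse>))"

lemma equiv_preorder_on:
  assumes "preorder_on A r"
  shows "equiv A (r \<inter> r\<inverse>)"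
  using assms
  by (auto simp: preorder_on_def intro!: equivI refl_onI symI transI dest: refl_onD transD)

text \<open>Both notions apply to nonempty subsets only: the empty set is neither bounded nor unbounded.\<close>

definition bounded_in :: "'a set \<Rightarrow> 'a rel \<Rightarrow> 'a set \<Rightarrow> bool" where
  "bounded_in A r X \<longleftrightarrow> X \<noteq> {} \<and> X \<subseteq> A \<and> (\<exists>b\<in>A. \<forall>x\<in>X. (x, b) \<in> r)"

definition unbounded_in :: "'a set \<Rightarrow> 'a rel \<Rightarrow> 'a set \<Rightarrow> bool" where
  "unbounded_in A r X \<longleftrightarrow> X \<noteq> {} \<and> X \<subseteq> A \<and> \<not> bounded_in A r X"

definition directed_preorder :: "'a set \<Rightarrow> 'a rel \<Rightarrow> bool" where
  "directed_preorder A r \<longleftrightarrow>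
     preorder_on A r \<and> (\<forall>X\<subseteq>A. card X = 2 \<longrightarrow> bounded_in A r X)"

definition tukey_map :: "'a set \<Rightarrow> 'a rel \<Rightarrow> 'b set \<Rightarrow> 'b rel \<Rightarrow> ('a \<Rightarrow> 'b) \<Rightarrow> bool" where
  "tukey_map A r B s f \<longleftrightarrow>
     f \<in> A \<rightarrow> B \<and> (\<forall>X\<subseteq>A. unbounded_in A r X \<longrightarrow> unbounded_in B s (f ` X))"

definition tukey_le :: "'a set \<Rightarrow> 'a rel \<Rightarrow> 'b set \<Rightarrow> 'b rel \<Rightarrow> bool" where
  "tukey_le A r B s \<longleftrightarrow> (\<exists>f. tukey_map A r B s f)"

section \<open>Categories and pre-adjunctions\<close>

text \<open>\<open>Comp C g f\<close> is the composite \<open>g \<cdot> f\<close>: first \<open>f\<close>, then \<open>g\<close>.\<close>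

record ('o, 'm) cat =
  Ob :: "'o set"
  Hom :: "'o \<Rightarrow> 'o \<Rightarrow> 'm set"
  Comp :: "'m \<Rightarrow> 'm \<Rightarrow> 'm"
  Ident :: "'o \<Rightarrow> 'm"

text \<open>
  Local smallness is automatic, as hom-sets are HOL sets. Hom-sets of distinct pairs of objects
  are disjoint, so composition needs no object arguments.
\<close>

locale category =
  fixes C :: "('o, 'm) cat"
  assumes Hom_disjoint:
      "\<lbrakk>X \<in> Ob C; Y \<in> Ob C; X' \<in> Ob C; Y' \<in> Ob C; f \<in> Hom C X Y; f \<in> Hom C X' Y'\<rbrakk>
        \<Longrightarrow> X = X' \<and> Y = Y'"
    and Comp_in_Hom:
      "\<lbrakk>X \<in> Ob C; Y \<in> Ob C; Z \<in> Ob C; f \<in> Hom C X Y; g \<in> Hom C Y Z\<rbrakk>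
        \<Longrightarrow> Comp C g f \<in> Hom C X Z"
    and Ident_in_Hom: "X \<in> Ob C \<Longrightarrow> Ident C X \<in> Hom C X X"
    and Comp_Ident_right:
      "\<lbrakk>X \<in> Ob C; Y \<in> Ob C; f \<in> Hom C X Y\<rbrakk> \<Longrightarrow> Comp C f (Ident C X) = f"
    and Comp_Ident_left:
      "\<lbrakk>X \<in> Ob C; Y \<in> Ob C; f \<in> Hom C X Y\<rbrakk> \<Longrightarrow> Comp C (Ident C Y) f = f"
    and Comp_assoc:
      "\<lbrakk>W \<in> Ob C; X \<in> Ob C; Y \<in> Ob C; Z \<in> Ob C;
        f \<in> Hom C W X; g \<in> Hom C X Y; h \<in> Hom C Y Z\<rbrakk>
        \<Longrightarrow> Comp C h (Comp C g f) = Comp C (Comp C h g) f"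

text \<open>The unique morphism \<open>a \<rightarrow> b\<close> for \<open>a \<le> b\<close> is the pair \<open>(a, b)\<close> itself.\<close>

definition thin_cat :: "'a set \<Rightarrow> 'a rel \<Rightarrow> ('a, 'a \<times> 'a) cat" where
  "thin_cat A r =
     \<lparr>Ob = A,
      Hom = (\<lambda>a b. if (a, b) \<in> r then {(a, b)} else {}),
      Comp = (\<lambda>g f. (fst f, snd g)),
      Ident = (\<lambda>a. (a, a))\<rparr>"

lemma category_thin_cat:
  assumes "preorder_on A r"
  shows "category (thin_cat A r)"
  using assms
  by unfold_locales
    (auto simp: thin_cat_def preorder_on_def split: if_splits dest: refl_onD transD)

definition pre_adjunction ::
  "('o1, 'm1) cat \<Rightarrow> ('o2, 'm2) cat \<Rightarrow> ('o1 \<Rightarrow> 'o2) \<Rightarrow> ('o2 \<Rightarrow> 'o1) \<Rightarrow> bool" where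
  "pre_adjunction \<B> \<C> F H \<longleftrightarrow>
     category \<B> \<and> category \<C> \<and> F \<in> Ob \<B> \<rightarrow> Ob \<C> \<and> H \<in> Ob \<C> \<rightarrow> Ob \<B> \<and>
     (\<exists>\<Phi>. (\<forall>X\<in>Ob \<B>. \<forall>Y\<in>Ob \<C>. \<Phi> X Y \<in> Hom \<C> (F X) Y \<rightarrow> Hom \<B> X (H Y)) \<and>
          (\<forall>C\<in>Ob \<C>. \<forall>A\<in>Ob \<B>. \<forall>B\<in>Ob \<B>. \<forall>u\<in>Hom \<C> (F B) C. \<forall>f\<in>Hom \<B> A B.
             \<exists>v\<in>Hom \<C> (F A) (F B). Comp \<B> (\<Phi> B C u) f = \<Phi> A C (Comp \<C> u v)))"

end

theory Submission
  imports Defs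
begin

text \<open>
  Between thin categories a pre-adjunction is a monotone map \<open>F\<close> together with a map \<open>H\<close> such that
  \<open>F x \<le> y\<close> implies \<open>x \<le> H y\<close>; such an \<open>F\<close> is a Tukey map. Conversely, assume \<open>B \<le>\<^sub>T C\<close>. If \<open>C\<close>
  has a top, then so has \<open>B\<close>, and constant maps do. Otherwise choose cofinal increasing sequences
  \<open>b\<close> in \<open>B\<close> and \<open>c\<close> in \<open>C\<close>, and let \<open>F x = c n\<close> for the least \<open>n\<close> with \<open>x \<le> b n\<close>. As \<open>y\<close> is not a
  top of \<open>C\<close>, some \<open>c m\<close> is not below \<open>y\<close>, and \<open>H y = b m\<close> works.
\<close>

text \<open>Directedness speaks of two-element sets, so \<open>x = y\<close> is settled by
  reflexivity.\<close>

lemma directed_preorder_upper_bound: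
  assumes "directed_preorder A r" "x \<in> A" "y \<in> A"
  obtains z where "z \<in> A" "(x, z) \<in> r" "(y, z) \<in> r"
proof (cases "x = y")
  case True
  then have "(x, x) \<in> r"
    using assms by (auto simp: directed_preorder_def preorder_on_def dest: refl_onD)
  with True that assms show ?thesis by blast
next
  case False
  then have "bounded_in A r {x, y}"
    using assms by (auto simp: directed_preorder_def)
  with that show ?thesis by (auto simp: bounded_in_def)
qed

text \<open>Enumerate the classes, possibly with repetitions, and let \<open>t n\<close> be any
  member of the \<open>n\<close>-th one: each \<open>x\<close> is equivalent to the member chosen
  from its own class.\<close>

lemma essentially_countable_representatives:
  assumes "preorder_on A r" "essentially_countable A r" "A \<noteq> {}"
  obtains t :: "nat \<Rightarrow> 'a" where "\<And>n. t n \<in> A" "\<And>x. x \<in> A \<Longrightarrow> \<exists>n. (x, t n) \<in> r"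
proof -
  let ?E = "r \<inter> r\<inverse>"
  have E: "equiv A ?E"
    using assms(1) by (rule equiv_preorder_on)
  have Q: "A // ?E \<noteq> {}"
    using assms(3) by (simp add: quotient_is_empty)
  have "\<exists>x. x \<in> from_nat_into (A // ?E) n" for n
    using in_quotient_imp_non_empty[OF E from_nat_into[OF Q]] by blast
  then obtain t where t: "\<And>n. t n \<in> from_nat_into (A // ?E) n" by metis
  show ?thesis
  proof
    show "t n \<in> A" for n
      using t in_quotient_imp_subset[OF E from_nat_into[OF Q]] by blast
    fix x assume "x \<in> A"
    then have "?E `` {x} \<in> A // ?E" by (rule quotientI)
    then obtain n where "from_nat_into (A // ?E) n = ?E `` {x}"
      using assms(2) from_nat_into_surj unfolding essentially_countable_def by metis
    with t[of n] show "\<exists>n. (x, t n) \<in> r" by auto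
  qed
qed

lemma directed_preorder_cofinal_sequence:
  assumes "directed_preorder A r" "essentially_countable A r" "A \<noteq> {}"
  obtains b :: "nat \<Rightarrow> 'a" where "\<And>n. b n \<in> A" "\<And>m n. m \<le> n \<Longrightarrow> (b m, b n) \<in> r"
    "\<And>x. x \<in> A \<Longrightarrow> \<exists>n. (x, b n) \<in> r"
proof -
  have pre: "preorder_on A r"
    using assms(1) by (simp add: directed_preorder_def)
  then have refl: "\<And>x. x \<in> A \<Longrightarrow> (x, x) \<in> r" and trans: "trans r"
    by (auto simp: preorder_on_def dest: refl_onD)
  obtain t :: "nat \<Rightarrow> 'a" where t: "\<And>n. t n \<in> A" "\<And>x. x \<in> A \<Longrightarrow> \<exists>n. (x, t n) \<in> r"
    using essentially_countable_representatives[OF pre assms(2,3)] by blast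
  \<comment> \<open>Directedness builds \<open>b\<close> recursively: \<open>b (Suc n)\<close> is an
    upper bound of \<open>b n\<close> and \<open>t (Suc n)\<close>, so \<open>b\<close> increases
    and inherits cofinality from \<open>t\<close>.\<close>
  have "\<exists>b. \<forall>n. (b n \<in> A \<and> (t n, b n) \<in> r) \<and> (b n, b (Suc n)) \<in> r"
  proof (rule dependent_nat_choice)
    show "\<exists>x. x \<in> A \<and> (t 0, x) \<in> r" using t(1) refl by blast
    show "\<exists>y. (y \<in> A \<and> (t (Suc n), y) \<in> r) \<and> (x, y) \<in> r" if "x \<in> A \<and> (t n, x) \<in> r" for x n
      using directed_preorder_upper_bound[OF assms(1), of x "t (Suc n)"] that t(1) by blast
  qed
  then obtain b where b: "\<And>n. b n \<in> A" "\<And>n. (t n, b n) \<in> r" "\<And>n. (b n, b (Suc n)) \<in> r"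
    by blast
  show ?thesis
  proof
    show "b n \<in> A" for n by (rule b)
    show "(b m, b n) \<in> r" if "m \<le> n" for m n
      using that by (induction rule: dec_induct) (use refl b trans in \<open>blast dest: transD\<close>)+
    show "\<exists>n. (x, b n) \<in> r" if "x \<in> A" for x
      using t(2)[OF that] b(2) trans by (blast dest: transD)
  qed
qed

text \<open>In a thin category parallel morphisms coincide, so the equation in (PA) is automatic and
  what (PA) demands is the existence of \<open>v\<close>, that is, monotonicity of \<open>F\<close>.
  The existence of \<Phi> is the last condition.\<close>

lemma pre_adjunction_thin_cat_iff:
  assumes "preorder_on B r" "preorder_on C s"
  shows "pre_adjunction (thin_cat B r) (thin_cat C s) F H \<longleftrightarrow>
    F \<in> B \<rightarrow> C \<and> H \<in> C \<rightarrow> B \<and>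
    (\<forall>x\<in>B. \<forall>y\<in>B. (x, y) \<in> r \<longrightarrow> (F x, F y) \<in> s) \<and>
    (\<forall>x\<in>B. \<forall>y\<in>C. (F x, y) \<in> s \<longrightarrow> (x, H y) \<in> r)"
    (is "?L \<longleftrightarrow> ?R")
proof
  assume ?L
  then have F: "F \<in> B \<rightarrow> C" and H: "H \<in> C \<rightarrow> B"
    by (simp_all add: pre_adjunction_def thin_cat_def)
  from \<open>?L\<close> obtain \<Phi> where
    \<Phi>: "\<forall>X\<in>B. \<forall>Y\<in>C. \<Phi> X Y \<in> Hom (thin_cat C s) (F X) Y \<rightarrow> Hom (thin_cat B r) X (H Y)"
    and PA: "\<forall>c\<in>C. \<forall>x\<in>B. \<forall>y\<in>B. \<forall>u\<in>Hom (thin_cat C s) (F y) c. \<forall>f\<in>Hom (thin_cat B r) x y.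
      \<exists>v\<in>Hom (thin_cat C s) (F x) (F y).
        Comp (thin_cat B r) (\<Phi> y c u) f = \<Phi> x c (Comp (thin_cat C s) u v)"
    unfolding pre_adjunction_def thin_cat_def cat.simps by blast
  have "(F x, F y) \<in> s" if xy: "x \<in> B" "y \<in> B" "(x, y) \<in> r" for x y
  proof -
    \<comment> \<open>(PA) yields \<open>v\<close> only in the presence of some \<open>u\<close> out
      of \<open>F y\<close>; the identity of \<open>F y\<close> serves.\<close>
    have "F y \<in> C" using F xy by auto
    then have "(F y, F y) \<in> s" using assms(2) by (auto simp: preorder_on_def dest: refl_onD)
    then have "(F y, F y) \<in> Hom (thin_cat C s) (F y) (F y)" "(x, y) \<in> Hom (thin_cat B r) x y"
      using xy(3) by (simp_all add: thin_cat_def)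
    then obtain v where "v \<in> Hom (thin_cat C s) (F x) (F y)"
      using PA \<open>F y \<in> C\<close> xy(1,2) by blast
    then show ?thesis by (simp add: thin_cat_def split: if_splits)
  qed
  moreover have "(x, H y) \<in> r" if "x \<in> B" "y \<in> C" "(F x, y) \<in> s" for x y
    using bspec[OF bspec[OF \<Phi> that(1)] that(2)] that(3) by (auto simp: thin_cat_def split: if_splits)
  ultimately show ?R using F H by blast
next
  assume ?R
  then show ?L
    unfolding pre_adjunction_def using assms
    \<comment> \<open>\<Phi> has no choice: its value must be the unique morphism from
      \<open>x\<close> to \<open>H y\<close>.\<close>
    by (intro conjI category_thin_cat exI[of _ "\<lambda>x y u. (x, H y)"])
      (auto simp: thin_cat_def split: if_splits)
qed

text \<open>By contraposition: if \<open>y\<close> bounds the image of \<open>X\<close>, then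
  \<open>H y\<close> bounds \<open>X\<close>.\<close>

lemma tukey_mapI:
  assumes "F \<in> B \<rightarrow> C" "H \<in> C \<rightarrow> B"
    and "\<And>x y. x \<in> B \<Longrightarrow> y \<in> C \<Longrightarrow> (F x, y) \<in> s \<Longrightarrow> (x, H y) \<in> r"
  shows "tukey_map B r C s F"
  unfolding tukey_map_def
proof (intro conjI allI impI)
  fix X assume X: "X \<subseteq> B" "unbounded_in B r X"
  have "\<not> bounded_in C s (F ` X)"
  proof
    assume "bounded_in C s (F ` X)"
    then obtain y where "y \<in> C" "\<forall>x\<in>X. (F x, y) \<in> s" by (auto simp: bounded_in_def)
    then have "H y \<in> B" "\<forall>x\<in>X. (x, H y) \<in> r" using assms X(1) by auto
    with X show False by (auto simp: unbounded_in_def bounded_in_def)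
  qed
  with X assms(1) show "unbounded_in C s (F ` X)" by (auto simp: unbounded_in_def)
qed (rule assms(1))

text \<open>Were \<open>B\<close> unbounded, its image under a Tukey map would be an unbounded
  subset of \<open>C\<close>, but a bound of \<open>C\<close> bounds every nonempty subset.\<close>

lemma tukey_le_bounded:
  assumes "tukey_le B r C s" "bounded_in C s C" "B \<noteq> {}"
  shows "bounded_in B r B"
proof (rule ccontr)
  assume "\<not> bounded_in B r B"
  moreover obtain f where "f \<in> B \<rightarrow> C"
    "\<forall>X\<subseteq>B. unbounded_in B r X \<longrightarrow> unbounded_in C s (f ` X)"
    using assms(1) by (auto simp: tukey_le_def tukey_map_def)
  ultimately have "unbounded_in C s (f ` B)" "f ` B \<subseteq> C"
    using assms(3) by (auto simp: unbounded_in_def)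
  with assms(2) show False by (fastforce simp: unbounded_in_def bounded_in_def)
qed

text \<open>A Tukey map need not be monotone, so \<open>F\<close> is constructed afresh; the given
  map serves to transfer a top from \<open>C\<close> to \<open>B\<close>.\<close>

lemma monotone_tukey_map_exists:
  assumes B: "B \<noteq> {}" "directed_preorder B r" "essentially_countable B r"
    and C: "C \<noteq> {}" "directed_preorder C s" "essentially_countable C s"
    and le: "tukey_le B r C s"
  obtains F H where "F \<in> B \<rightarrow> C" "H \<in> C \<rightarrow> B"
    "\<And>x y. x \<in> B \<Longrightarrow> y \<in> B \<Longrightarrow> (x, y) \<in> r \<Longrightarrow> (F x, F y) \<in> s"
    "\<And>x y. x \<in> B \<Longrightarrow> y \<in> C \<Longrightarrow> (F x, y) \<in> s \<Longrightarrow> (x, H y) \<in> r"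
proof (cases "bounded_in C s C")
  case True
  then obtain b where "b \<in> B" "\<forall>x\<in>B. (x, b) \<in> r"
    using tukey_le_bounded[OF le _ B(1)] by (auto simp: bounded_in_def)
  moreover obtain c where "c \<in> C" "(c, c) \<in> s"
    using C(1,2) by (auto simp: directed_preorder_def preorder_on_def dest: refl_onD)
  ultimately show ?thesis
    by (intro that[of "\<lambda>_. c" "\<lambda>_. b"]) auto
next
  case False
  have trans: "trans r" "trans s"
    using B(2) C(2) by (auto simp: directed_preorder_def preorder_on_def)
  obtain b :: "nat \<Rightarrow> _" where b: "\<And>n. b n \<in> B" "\<And>m n. m \<le> n \<Longrightarrow> (b m, b n) \<in> r"
    "\<And>x. x \<in> B \<Longrightarrow> \<exists>n. (x, b n) \<in> r"
    using directed_preorder_cofinal_sequence[OF B(2,3,1)] by blast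
  obtain c :: "nat \<Rightarrow> _" where c: "\<And>n. c n \<in> C" "\<And>m n. m \<le> n \<Longrightarrow> (c m, c n) \<in> s"
    "\<And>x. x \<in> C \<Longrightarrow> \<exists>n. (x, c n) \<in> s"
    using directed_preorder_cofinal_sequence[OF C(2,3,1)] by blast
  \<comment> \<open>Taking the least index makes \<open>rank\<close> monotone: if \<open>x\<close>
    is below \<open>y\<close>, every \<open>b n\<close> above \<open>y\<close> is also above
    \<open>x\<close>.\<close>
  define rank where "rank x = (LEAST n. (x, b n) \<in> r)" for x
  have rank: "(x, b (rank x)) \<in> r" if "x \<in> B" for x
    unfolding rank_def using b(3)[OF that] by (rule LeastI_ex)
  have rank_mono: "rank x \<le> rank y" if "y \<in> B" "(x, y) \<in> r" for x y
  proof -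
    have "(x, b (rank y)) \<in> r"
      using trans(1) that(2) rank[OF that(1)] by (rule transD)
    then show ?thesis unfolding rank_def[of x] by (rule Least_le)
  qed
  \<comment> \<open>Otherwise \<open>y\<close> would bound the cofinal sequence \<open>c\<close>,
    hence all of \<open>C\<close>.\<close>
  have "\<exists>m. (c m, y) \<notin> s" if "y \<in> C" for y
  proof (rule ccontr)
    assume "\<nexists>m. (c m, y) \<notin> s"
    then have "\<forall>x\<in>C. (x, y) \<in> s" using c(3) trans(2) by (blast dest: transD)
    with that False C(1) show False by (auto simp: bounded_in_def)
  qed
  then obtain h where h: "\<And>y. y \<in> C \<Longrightarrow> (c (h y), y) \<notin> s" by metis
  show ?thesis
  proof
    show "(\<lambda>x. c (rank x)) \<in> B \<rightarrow> C" "(\<lambda>y. b (h y)) \<in> C \<rightarrow> B" using b(1) c(1) by auto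
    show "(c (rank x), c (rank y)) \<in> s" if "x \<in> B" "y \<in> B" "(x, y) \<in> r" for x y
      using c(2) rank_mono that by blast
    fix x y assume xy: "x \<in> B" "y \<in> C" "(c (rank x), y) \<in> s"
    \<comment> \<open>If \<open>h y\<close> were smaller than \<open>rank x\<close>, then
      \<open>c (h y)\<close> would lie below \<open>c (rank x)\<close> and so below
      \<open>y\<close>, against the choice of \<open>h\<close>.\<close>
    have "rank x \<le> h y"
    proof (rule ccontr)
      assume "\<not> rank x \<le> h y"
      then have "(c (h y), c (rank x)) \<in> s" by (intro c(2)) simp
      with xy h trans(2) show False by (blast dest: transD)
    qed
    then show "(x, b (h y)) \<in> r"
      using rank[OF xy(1)] b(2) trans(1) by (blast dest: transD)
  qed
qed

theorem theorem3p3: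
  fixes B :: "'b set" and r :: "'b rel" and C :: "'c set" and s :: "'c rel"
  assumes "B \<noteq> {}" and "directed_preorder B r" and "essentially_countable B r"
    and "C \<noteq> {}" and "directed_preorder C s" and "essentially_countable C s"
  shows "tukey_le B r C s \<longleftrightarrow> (\<exists>F H. pre_adjunction (thin_cat B r) (thin_cat C s) F H)"
proof -
  have pre: "preorder_on B r" "preorder_on C s"
    using assms by (auto simp: directed_preorder_def)
  show ?thesis
    unfolding pre_adjunction_thin_cat_iff[OF pre]
  proof
    assume "tukey_le B r C s"
    then obtain F H where "F \<in> B \<rightarrow> C" "H \<in> C \<rightarrow> B"
      "\<And>x y. x \<in> B \<Longrightarrow> y \<in> B \<Longrightarrow> (x, y) \<in> r \<Longrightarrow> (F x, F y) \<in> s"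
      "\<And>x y. x \<in> B \<Longrightarrow> y \<in> C \<Longrightarrow> (F x, y) \<in> s \<Longrightarrow> (x, H y) \<in> r"
      using monotone_tukey_map_exists[OF assms] by metis
    then show "\<exists>F H. F \<in> B \<rightarrow> C \<and> H \<in> C \<rightarrow> B \<and>
      (\<forall>x\<in>B. \<forall>y\<in>B. (x, y) \<in> r \<longrightarrow> (F x, F y) \<in> s) \<and>
      (\<forall>x\<in>B. \<forall>y\<in>C. (F x, y) \<in> s \<longrightarrow> (x, H y) \<in> r)"
      by blast
  next
    assume "\<exists>F H. F \<in> B \<rightarrow> C \<and> H \<in> C \<rightarrow> B \<and>
      (\<forall>x\<in>B. \<forall>y\<in>B. (x, y) \<in> r \<longrightarrow> (F x, F y) \<in> s) \<and>
      (\<forall>x\<in>B. \<forall>y\<in>C. (F x, y) \<in> s \<longrightarrow> (x, H y) \<in> r)"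
    \<comment> \<open>The map \<open>F\<close> of the pre-adjunction is itself the Tukey map, with
      \<open>H\<close> supplying the bounds.\<close>
    then obtain F H where "F \<in> B \<rightarrow> C" "H \<in> C \<rightarrow> B"
      "\<And>x y. x \<in> B \<Longrightarrow> y \<in> C \<Longrightarrow> (F x, y) \<in> s \<Longrightarrow> (x, H y) \<in> r"
      by blast
    then show "tukey_le B r C s"
      unfolding tukey_le_def by (intro exI tukey_mapI)
  qed
qed

end
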